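(* Let $\{\Gamma_c\}_{c\in(0,1)}$ be a family of admissible policies such that $R_j(\Gamma_c)=O(-c\log c)$ as $c\to0$ for every $j=1,\dots,M$. Then for every $m=1,\dots,M$, $$R_m(\Gamma_c)\ge-(1+o(1))\frac{c\log c}{I^*(M,K)}\qquad (c\to0).$$
   Context: Model. Fix integers $M\ge2$, $1\le K\le M$. There are $M$ cells, exactly one containing a target; $H_m$: the target is in cell $m$. $f,g$ are probability densities w.r.t. a common measure with $0<D(g\|f),D(f\|g)<\infty$ ($D(p\|q)=\int p\log(p/q)$), and $\log(g(Y)/f(Y))$ has finite moment generating function near $0$ for $Y\sim f$ and $Y\sim g$. At each time $n$ a set $\phi(n)$ of $K$ distinct cells is selected and an observation is obtained from each; under $H_m$ observations are independent with law $g$ from cell $m$ and $f$ from other cells. An admissible policy $\Gamma=(\tau,\delta,\boldsymbol\phi)$: a (possibly randomized) history-dependent selection rule, a stopping time $\tau$, and a decision $\delta\in\{1,\dots,M\}$. $\mathbf P_m,\mathbf E_m$ under $H_m$; $\alpha_m(\Gamma)=\mathbf P_m(\delta\ne m)$, and for cost $c>0$ per time step $R_m(\Gamma)=\alpha_m(\Gamma)+c\,\mathbf E_m(\tau)$ (with $\Gamma_c$ using cost $c$). $I^*(M,K)=D(g\|f)+D(f\|g)$ if $K=M$; $I^*(M,K)=\max\big[\frac{KD(f\|g)}{M-1},D(g\|f)+\frac{(K-1)D(f\|g)}{M-1}\big]$ if $K<M$. *)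

theory Defs
  imports "HOL-Probability.Probability"
begin

text \<open>Histories: list of (selected set of cells, observations from those cells).\<close>
type_synonym 'a history = "(nat set \<times> (nat \<Rightarrow> 'a)) list"

text \<open>A (possibly randomized) policy: every rule may depend on a randomization seed
  u (uniform on [0,1], independent of the observations) and on the observed history.
  sel: next set of cells; stp: stop after this history?; dec: final decision.\<close>
datatype 'a policy = Policy
  (sel: "real \<Rightarrow> 'a history \<Rightarrow> nat set")
  (stp: "real \<Rightarrow> 'a history \<Rightarrow> bool")
  (dec: "real \<Rightarrow> 'a history \<Rightarrow> nat")

text \<open>Observed history after n steps; x (n,i) is the potential observation of cell i at time n.\<close>
fun hist :: "'a policy \<Rightarrow> real \<Rightarrow> (nat \<times> nat \<Rightarrow> 'a) \<Rightarrow> nat \<Rightarrow> 'a history" where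
  "hist P u x 0 = []"
| "hist P u x (Suc n) =
     (let h = hist P u x n; S = sel P u h in h @ [(S, restrict (\<lambda>i. x (n, i)) S)])"

definition stoptime :: "'a policy \<Rightarrow> real \<Rightarrow> (nat \<times> nat \<Rightarrow> 'a) \<Rightarrow> enat" where
  "stoptime P u x =
     (if \<exists>n. stp P u (hist P u x n) then enat (LEAST n. stp P u (hist P u x n)) else \<infinity>)"

definition decision :: "'a policy \<Rightarrow> real \<Rightarrow> (nat \<times> nat \<Rightarrow> 'a) \<Rightarrow> nat" where
  "decision P u x = dec P u (hist P u x (the_enat (stoptime P u x)))"

definition sample_space :: "'a measure \<Rightarrow> (real \<times> (nat \<times> nat \<Rightarrow> 'a)) measure" where
  "sample_space \<mu> = uniform_measure lborel {0..1::real} \<Otimes>\<^sub>M (\<Pi>\<^sub>M _\<in>UNIV. \<mu>)"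

definition Pm :: "'a measure \<Rightarrow> ('a \<Rightarrow> real) \<Rightarrow> ('a \<Rightarrow> real) \<Rightarrow> nat
                  \<Rightarrow> (real \<times> (nat \<times> nat \<Rightarrow> 'a)) measure" where
  "Pm \<mu> f g m = uniform_measure lborel {0..1::real} \<Otimes>\<^sub>M
      (\<Pi>\<^sub>M ni\<in>UNIV. density \<mu> (\<lambda>y. ennreal (if snd ni = m then g y else f y)))"

definition admissible :: "nat \<Rightarrow> nat \<Rightarrow> 'a measure \<Rightarrow> 'a policy \<Rightarrow> bool" where
  "admissible M K \<mu> P \<longleftrightarrow>
     (\<forall>u h. sel P u h \<subseteq> {1..M} \<and> card (sel P u h) = K) \<and>
     (\<forall>n. (\<lambda>(u, x). sel P u (hist P u x n)) \<in> measurable (sample_space \<mu>) (count_space UNIV)) \<and>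
     (\<forall>n. (\<lambda>(u, x). stp P u (hist P u x n)) \<in> measurable (sample_space \<mu>) (count_space UNIV)) \<and>
     (\<forall>n. (\<lambda>(u, x). dec P u (hist P u x n)) \<in> measurable (sample_space \<mu>) (count_space UNIV))"

definition err_prob :: "'a measure \<Rightarrow> ('a \<Rightarrow> real) \<Rightarrow> ('a \<Rightarrow> real) \<Rightarrow> nat \<Rightarrow> 'a policy \<Rightarrow> ennreal" where
  "err_prob \<mu> f g m P = emeasure (Pm \<mu> f g m)
     {(u, x) \<in> space (Pm \<mu> f g m). stoptime P u x = \<infinity> \<or> decision P u x \<noteq> m}"

definition exp_time :: "'a measure \<Rightarrow> ('a \<Rightarrow> real) \<Rightarrow> ('a \<Rightarrow> real) \<Rightarrow> nat \<Rightarrow> 'a policy \<Rightarrow> ennreal" where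
  "exp_time \<mu> f g m P = (\<integral>\<^sup>+ (u, x). ennreal_of_enat (stoptime P u x) \<partial>Pm \<mu> f g m)"

definition risk :: "'a measure \<Rightarrow> ('a \<Rightarrow> real) \<Rightarrow> ('a \<Rightarrow> real) \<Rightarrow> nat \<Rightarrow> real \<Rightarrow> 'a policy \<Rightarrow> ennreal" where
  "risk \<mu> f g m c P = err_prob \<mu> f g m P + ennreal c * exp_time \<mu> f g m P"

definition KLdiv :: "'a measure \<Rightarrow> ('a \<Rightarrow> real) \<Rightarrow> ('a \<Rightarrow> real) \<Rightarrow> real" where
  "KLdiv \<mu> p q = (\<integral> y. p y * ln (p y / q y) \<partial>\<mu>)"

definition Istar :: "nat \<Rightarrow> nat \<Rightarrow> real \<Rightarrow> real \<Rightarrow> real" where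
  "Istar M K Dgf Dfg =
     (if K = M then Dgf + Dfg
      else max (real K * Dfg / (real M - 1)) (Dgf + (real K - 1) * Dfg / (real M - 1)))"

end

theory Submission
  imports Defs "HOL-Real_Asymp.Real_Asymp"
begin

text \<open>
  Fix \<open>a \<ge> 0\<close> and two hypotheses \<open>m \<noteq> j\<close>. Let \<open>A\<close> be the event that the policy decides for \<open>m\<close> within
  \<open>n\<close> steps and \<open>W\<close> the likelihood ratio of \<open>H\<^sub>j\<close> to \<open>H\<^sub>m\<close> of the observations made before stopping
  or time \<open>n\<close>. Integrating \<open>1 + ln W + a 1\<^sub>A \<le> W exp (a 1\<^sub>A)\<close> under \<open>H\<^sub>m\<close> bounds \<open>a P\<^sub>m(A)\<close> by
  \<open>(exp a - 1) P\<^sub>j(A)\<close> plus the expected log-likelihood, which is the expected number of observed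
  cells \<open>m\<close> times \<open>D(g\<parallel>f)\<close> plus that of observed cells \<open>j\<close> times \<open>D(f\<parallel>g)\<close>. Averaged over \<open>j\<close>, one time
  step contributes at most \<open>I\<^sup>*\<close> because only \<open>K\<close> cells are selected. Letting \<open>n \<rightarrow> \<infinity>\<close>, error
  probabilities at most \<open>q\<close> force \<open>a (1 - q) \<le> I\<^sup>* E\<^sub>m(\<tau>) + exp a q\<close>, and \<open>a = - ln (- c ln c)\<close> gives the
  rate.
\<close>

section \<open>Changing the law of coordinates of a product\<close>

text \<open>Tonelli: inserting coordinate \<open>i\<close> carries \<open>M i\<close> times the
  product of the other laws onto the full product, so this coordinate can be integrated
  first.\<close>

lemma nn_integral_PiM_component:
  fixes M :: "'i \<Rightarrow> 'a measure"
  assumes prob: "\<And>k. prob_space (M k)"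
    and F[measurable]: "F \<in> borel_measurable (PiM UNIV M)"
  shows "(\<integral>\<^sup>+x. F x \<partial>PiM UNIV M) = (\<integral>\<^sup>+x. (\<integral>\<^sup>+y. F (x(i := y)) \<partial>M i) \<partial>PiM (UNIV - {i}) M)"
proof -
  interpret Mi: prob_space "M i" by (rule prob)
  interpret R: prob_space "PiM (UNIV - {i}) M" by (intro prob_space_PiM prob)
  interpret pair_sigma_finite "M i" "PiM (UNIV - {i}) M" ..
  have ins: "insert i (UNIV - {i}) = UNIV" by auto
  note upd = measurable_add_dim[of i "UNIV - {i}" M, unfolded ins]
  have upd': "(\<lambda>(y, x). x(i := y)) \<in> M i \<Otimes>\<^sub>M PiM (UNIV - {i}) M \<rightarrow>\<^sub>M PiM UNIV M"
    using measurable_comp[OF measurable_pair_swap' upd]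
    by (simp add: comp_def split_beta')
  have F': "(\<lambda>(y, x). F (x(i := y))) \<in> borel_measurable (M i \<Otimes>\<^sub>M PiM (UNIV - {i}) M)"
    using measurable_comp[OF upd' F] by (simp add: comp_def split_beta')
  have "(\<integral>\<^sup>+x. F x \<partial>PiM UNIV M) =
      (\<integral>\<^sup>+x. F x \<partial>distr (M i \<Otimes>\<^sub>M PiM (UNIV - {i}) M) (PiM UNIV M) (\<lambda>(y, x). x(i := y)))"
    using distr_pair_PiM_eq_PiM[of "UNIV - {i}" M i] prob by (simp add: ins)
  also have "\<dots> = (\<integral>\<^sup>+(y, x). F (x(i := y)) \<partial>(M i \<Otimes>\<^sub>M PiM (UNIV - {i}) M))"
    by (subst nn_integral_distr[OF upd']) (simp_all add: F split_beta')
  also have "\<dots> = (\<integral>\<^sup>+x. (\<integral>\<^sup>+y. F (x(i := y)) \<partial>M i) \<partial>PiM (UNIV - {i}) M)"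
    using nn_integral_snd[OF F'] by simp
  finally show ?thesis .
qed

text \<open>A coordinate is only seen on \<open>B\<close>, and whether it is seen does not depend on its value;
  so only on \<open>B\<close> does the exchange of its law cost a density factor.\<close>

lemma nn_integral_PiM_swap_coordinate:
  fixes M M' :: "'i \<Rightarrow> 'a measure"
  assumes prob: "\<And>k. prob_space (M k)" "\<And>k. prob_space (M' k)"
    and eq: "\<And>k. k \<noteq> i \<Longrightarrow> M' k = M k"
    and dens: "M i = density (M' i) r" and r[measurable]: "r \<in> borel_measurable (M' i)"
    and F: "F \<in> borel_measurable (PiM UNIV M')"
    and B: "Measurable.pred (PiM UNIV M') (\<lambda>x. x \<in> B)"
    and B_upd: "\<And>x y. x(i := y) \<in> B \<longleftrightarrow> x \<in> B"
    and F_upd: "\<And>x y. x \<notin> B \<Longrightarrow> F (x(i := y)) = F x"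
  shows "(\<integral>\<^sup>+x. F x \<partial>PiM UNIV M) =
    (\<integral>\<^sup>+x. F x * (if x \<in> B then r (x i) else 1) \<partial>PiM UNIV M')"
proof -
  interpret Mi: prob_space "M i" by (rule prob)
  interpret Mi': prob_space "M' i" by (rule prob)
  have sets_eq: "sets (PiM UNIV M) = sets (PiM UNIV M')"
    using eq dens by (intro sets_PiM_cong) (metis sets_density)+
  have F': "F \<in> borel_measurable (PiM UNIV M)"
    using F by (simp add: measurable_cong_sets[OF sets_eq refl])
  note [measurable] = F B
  have Fw: "(\<lambda>x. F x * (if x \<in> B then r (x i) else 1)) \<in> borel_measurable (PiM UNIV M')"
    by measurable
  have PiM_eq: "PiM (UNIV - {i}) M = PiM (UNIV - {i}) M'"
    using eq by (intro PiM_cong) auto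
  \<comment> \<open>Here \<open>x\<close> carries no meaningful value at \<open>i\<close>, but by
    \<open>B_upd\<close> membership in \<open>B\<close> ignores that coordinate. On \<open>B\<close>
    the density enters; off \<open>B\<close> both integrands are constant in \<open>y\<close> and
    both laws have mass 1.\<close>
  have inner: "(\<integral>\<^sup>+y. F (x(i := y)) \<partial>M i) =
      (\<integral>\<^sup>+y. F (x(i := y)) * (if x(i := y) \<in> B then r ((x(i := y)) i) else 1) \<partial>M' i)"
    if x: "x \<in> space (PiM (UNIV - {i}) M')" for x
  proof (cases "x \<in> B")
    case True
    have "(\<lambda>y. x(i := y)) \<in> M' i \<rightarrow>\<^sub>M PiM (insert i (UNIV - {i})) M'"
      using x by (intro measurable_fun_upd[where J="UNIV - {i}"]) auto
    then have [measurable]: "(\<lambda>y. F (x(i := y))) \<in> borel_measurable (M' i)"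
      using measurable_comp[OF _ F] by (auto simp: comp_def insert_absorb)
    show ?thesis
      using True unfolding dens
      by (subst nn_integral_density) (auto simp: B_upd mult.commute)
  next
    case False
    then show ?thesis
      by (simp add: B_upd F_upd Mi.emeasure_space_1 Mi'.emeasure_space_1)
  qed
  show ?thesis
    unfolding nn_integral_PiM_component[OF prob(1) F', of i]
      nn_integral_PiM_component[OF prob(2) Fw, of i] PiM_eq
    by (intro nn_integral_cong inner)
qed

text \<open>The laws are exchanged one at a time. By \<open>B_upd'\<close>, altering an unseen
  coordinate leaves the weights collected so far unchanged, so the weighted integrand again has the
  invariance that the next exchange requires.\<close>

lemma nn_integral_PiM_swap_coordinates:
  fixes N N' :: "'i \<Rightarrow> 'a measure"
  assumes "finite J"
    and prob: "\<And>k. prob_space (N k)" "\<And>k. prob_space (N' k)"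
    and sets: "\<And>k. sets (N k) = sets (N' k)"
    and dens: "\<And>i. i \<in> J \<Longrightarrow> N i = density (N' i) (r i)"
    and r: "\<And>i. i \<in> J \<Longrightarrow> r i \<in> borel_measurable (N' i)"
    and F: "F \<in> borel_measurable (PiM UNIV N')"
    and B: "\<And>i. i \<in> J \<Longrightarrow> Measurable.pred (PiM UNIV N') (\<lambda>x. x \<in> B i)"
    and B_upd: "\<And>i x y. i \<in> J \<Longrightarrow> x(i := y) \<in> B i \<longleftrightarrow> x \<in> B i"
    and B_upd': "\<And>i k x y. i \<in> J \<Longrightarrow> k \<in> J \<Longrightarrow> x \<notin> B i \<Longrightarrow> x(i := y) \<in> B k \<longleftrightarrow> x \<in> B k"
    and F_upd: "\<And>i x y. i \<in> J \<Longrightarrow> x \<notin> B i \<Longrightarrow> F (x(i := y)) = F x"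
  shows "(\<integral>\<^sup>+x. F x \<partial>PiM UNIV N) =
    (\<integral>\<^sup>+x. F x * (\<Prod>i\<in>J. if x \<in> B i then r i (x i) else 1)
        \<partial>PiM UNIV (\<lambda>k. if k \<in> J then N' k else N k))"
  using assms
proof (induction J rule: finite_induct)
  case empty
  then show ?case by simp
next
  case (insert j J)
  let ?w = "\<lambda>i x. if x \<in> B i then r i (x i) else 1"
  let ?G = "\<lambda>x. F x * (\<Prod>i\<in>J. ?w i x)"
  let ?L = "\<lambda>J k. if k \<in> J then N' k else N k"
  have sets_L: "sets (PiM UNIV (?L I)) = sets (PiM UNIV N')" for I
    using sets by (intro sets_PiM_cong) auto
  have m: "h \<in> borel_measurable (PiM UNIV N') \<Longrightarrow> h \<in> borel_measurable (PiM UNIV (?L I))"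
    for h :: "_ \<Rightarrow> ennreal" and I
    by (simp add: measurable_cong_sets[OF sets_L refl])
  have w: "?w i \<in> borel_measurable (PiM UNIV N')" if "i \<in> J" for i
  proof -
    have [measurable]: "r i \<in> borel_measurable (N' i)" "Measurable.pred (PiM UNIV N') (\<lambda>x. x \<in> B i)"
      using that insert.prems by auto
    show ?thesis by measurable
  qed
  have "(\<integral>\<^sup>+x. F x \<partial>PiM UNIV N) = (\<integral>\<^sup>+x. ?G x \<partial>PiM UNIV (?L J))"
    by (rule insert.IH; rule insert.prems; simp)
  also have "\<dots> = (\<integral>\<^sup>+x. ?G x * ?w j x \<partial>PiM UNIV (?L (insert j J)))"
  proof (rule nn_integral_PiM_swap_coordinate)
    show "?G \<in> borel_measurable (PiM UNIV (?L (insert j J)))"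
      using insert.prems w by (intro m borel_measurable_times borel_measurable_prod) auto
    show "Measurable.pred (PiM UNIV (?L (insert j J))) (\<lambda>x. x \<in> B j)"
      using insert.prems by (simp only: measurable_cong_sets[OF sets_L refl]) auto
    show "x(j := y) \<in> B j \<longleftrightarrow> x \<in> B j" for x y
      by (rule insert.prems) simp
    show "?G (x(j := y)) = ?G x" if "x \<notin> B j" for x y
    proof -
      have "?w i (x(j := y)) = ?w i x" if "i \<in> J" for i
      proof -
        have "x(j := y) \<in> B i \<longleftrightarrow> x \<in> B i"
          using that \<open>x \<notin> B j\<close> by (intro insert.prems(9)[of j]) auto
        moreover have "i \<noteq> j" using that insert.hyps by auto
        ultimately show ?thesis by simp
      qed
      moreover have "F (x(j := y)) = F x"
        using that by (intro insert.prems(10)) auto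
      ultimately show ?thesis by simp
    qed
  qed (use insert in \<open>auto\<close>)
  also have "\<dots> = (\<integral>\<^sup>+x. F x * (\<Prod>i\<in>insert j J. ?w i x) \<partial>PiM UNIV (?L (insert j J)))"
    using insert.hyps by (simp add: mult_ac)
  finally show ?case .
qed

text \<open>Membership in \<open>B\<close> ignores coordinate \<open>i\<close>, so the two are
  independent. This is one term of Wald's identity: whether an observation is made is settled before
  its value is drawn.\<close>

lemma
  fixes M :: "'i \<Rightarrow> 'a measure" and h :: "'a \<Rightarrow> real"
  assumes prob: "\<And>k. prob_space (M k)"
    and h: "integrable (M i) h"
    and B[measurable]: "Measurable.pred (PiM UNIV M) (\<lambda>x. x \<in> B)"
    and B_upd: "\<And>x y. x(i := y) \<in> B \<longleftrightarrow> x \<in> B"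
  shows integrable_PiM_indicator_component: "integrable (PiM UNIV M) (\<lambda>x. indicator B x * h (x i))"
    and integral_PiM_indicator_component: "(\<integral>x. indicator B x * h (x i) \<partial>PiM UNIV M) =
      \<P>(x in PiM UNIV M. x \<in> B) * (\<integral>y. h y \<partial>M i)"
proof -
  interpret P: prob_space "PiM UNIV M" by (intro prob_space_PiM prob)
  interpret Mi: prob_space "M i" by (rule prob)
  \<comment> \<open>\<open>ennreal\<close> cuts negative values to 0, so taking \<open>k\<close> as
    \<open>h\<close> and as \<open>- h\<close> yields the positive and the negative part.\<close>
  have nn: "(\<integral>\<^sup>+x. ennreal (indicator B x * k (x i)) \<partial>PiM UNIV M) =
      emeasure (PiM UNIV M) {x \<in> space (PiM UNIV M). x \<in> B} * (\<integral>\<^sup>+y. ennreal (k y) \<partial>M i)"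
    if [measurable]: "k \<in> borel_measurable (M i)" for k :: "'a \<Rightarrow> real"
  proof -
    have e: "ennreal (indicator B x * k (x i)) = indicator B x * ennreal (k (x i))" for x
      by (simp split: split_indicator)
    have i_upd: "indicator B (x(i := y)) = (indicator B x :: ennreal)" for x y
      by (simp add: indicator_def B_upd)
    have "emeasure (PiM UNIV M) {x \<in> space (PiM UNIV M). x \<in> B} = (\<integral>\<^sup>+x. indicator B x \<partial>PiM UNIV M)"
    proof -
      have "B \<inter> space (PiM UNIV M) = {x \<in> space (PiM UNIV M). x \<in> B}" by auto
      moreover have "{x \<in> space (PiM UNIV M). x \<in> B} \<in> sets (PiM UNIV M)" by measurable
      ultimately show ?thesis by (simp add: nn_integral_indicator')
    qed
    also have "\<dots> = (\<integral>\<^sup>+x. indicator B x \<partial>PiM (UNIV - {i}) M)"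
      by (subst nn_integral_PiM_component[where M=M and i=i, OF prob])
        (auto simp: i_upd Mi.emeasure_space_1)
    finally have B_eq: "emeasure (PiM UNIV M) {x \<in> space (PiM UNIV M). x \<in> B} = (\<integral>\<^sup>+x. indicator B x \<partial>PiM (UNIV - {i}) M)" .
    have "(\<integral>\<^sup>+x. indicator B x * ennreal (k (x i)) \<partial>PiM UNIV M) =
        (\<integral>\<^sup>+x. indicator B x * (\<integral>\<^sup>+y. ennreal (k y) \<partial>M i) \<partial>PiM (UNIV - {i}) M)"
      by (subst nn_integral_PiM_component[where M=M and i=i, OF prob])
        (auto simp: i_upd nn_integral_cmult)
    also have "\<dots> = emeasure (PiM UNIV M) {x \<in> space (PiM UNIV M). x \<in> B} * (\<integral>\<^sup>+y. ennreal (k y) \<partial>M i)"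
      unfolding B_eq
    proof (rule nn_integral_multc)
      \<comment> \<open>Any fixed value can fill the missing coordinate; by \<open>B_upd\<close> the
        indicator does not notice it.\<close>
      obtain y where "y \<in> space (M i)" using Mi.not_empty by auto
      then have "(\<lambda>x. x(i := y)) \<in> PiM (UNIV - {i}) M \<rightarrow>\<^sub>M PiM UNIV M"
        by (intro measurable_fun_upd[where J="UNIV - {i}"]) auto
      then have "(\<lambda>x. indicator B (x(i := y)) :: ennreal) \<in> borel_measurable (PiM (UNIV - {i}) M)"
        by measurable
      then show "(indicator B :: _ \<Rightarrow> ennreal) \<in> borel_measurable (PiM (UNIV - {i}) M)"
        by (simp add: i_upd)
    qed
    finally show ?thesis by (simp add: e)
  qed
  have h_meas[measurable]: "h \<in> borel_measurable (M i)" using h by auto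
  have neg: "(\<lambda>x. ennreal (- (indicator B x * h (x i)))) = (\<lambda>x. ennreal (indicator B x * (- h (x i))))"
    by simp
  note pos_part = nn[OF h_meas] and neg_part = nn[OF borel_measurable_uminus[OF h_meas]]
  show int: "integrable (PiM UNIV M) (\<lambda>x. indicator B x * h (x i))"
    using h unfolding real_integrable_def neg pos_part neg_part
    by (auto simp: ennreal_mult_eq_top_iff)
  show "(\<integral>x. indicator B x * h (x i) \<partial>PiM UNIV M) =
      \<P>(x in PiM UNIV M. x \<in> B) * (\<integral>y. h y \<partial>M i)"
    unfolding real_lebesgue_integral_def[OF int] real_lebesgue_integral_def[OF h] neg pos_part neg_part
    by (simp add: enn2real_mult measure_def right_diff_distrib)
qed

text \<open>Such an event is determined by the marginal on \<open>D\<close>, which is the product of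
  the laws there. This allows the laws outside a finite window to differ.\<close>

lemma prob_PiM_cong_coordinates:
  fixes N N' :: "'i \<Rightarrow> 'a measure"
  assumes "finite D"
    and prob: "\<And>k. prob_space (N k)" "\<And>k. prob_space (N' k)"
    and sets: "\<And>k. sets (N k) = sets (N' k)"
    and eq: "\<And>k. k \<in> D \<Longrightarrow> N k = N' k"
    and A: "Measurable.pred (PiM UNIV N) (\<lambda>x. x \<in> A)"
    and A_cong: "\<And>x y. (\<And>k. k \<in> D \<Longrightarrow> x k = y k) \<Longrightarrow> x \<in> A \<longleftrightarrow> y \<in> A"
  shows "\<P>(x in PiM UNIV N. x \<in> A) = \<P>(x in PiM UNIV N'. x \<in> A)"
proof -
  have "\<exists>z. z \<in> space (N k)" for k
    using prob_space.not_empty[OF prob(1)] by blast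
  then obtain z where z: "\<And>k. z k \<in> space (N k)" by metis
  \<comment> \<open>\<open>T\<close> pads a point of the finite product with the fixed values
    \<open>z\<close>; by \<open>A_cong\<close> this turns \<open>A\<close> into an event of the
    marginal.\<close>
  define T where "T x = (\<lambda>k. if k \<in> D then x k else z k)" for x :: "'i \<Rightarrow> 'a"
  have proj: "emeasure (PiM UNIV L) {x \<in> space (PiM UNIV L). x \<in> A} =
      emeasure (PiM D L) (T -` A \<inter> space (PiM D L))"
    if pL: "\<And>k. prob_space (L k)" and sL: "\<And>k. sets (L k) = sets (N k)" for L
  proof -
    interpret product_prob_space L UNIV
      using pL by (simp add: product_prob_space_def product_sigma_finite_def
          product_prob_space_axioms_def prob_space_imp_sigma_finite)
    have sp: "space (L k) = space (N k)" for k using sL by (rule sets_eq_imp_space_eq)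
    have "sets (PiM UNIV L) = sets (PiM UNIV N)"
      using sL by (intro sets_PiM_cong) auto
    then have AL: "Measurable.pred (PiM UNIV L) (\<lambda>x. x \<in> A)"
      using A by (subst measurable_cong_sets[OF _ refl])
    have T: "T \<in> PiM D L \<rightarrow>\<^sub>M PiM UNIV L"
      unfolding T_def
    proof (rule measurable_PiM_single')
      show "(\<lambda>x. if k \<in> D then x k else z k) \<in> PiM D L \<rightarrow>\<^sub>M L k" for k
        using z sp by (cases "k \<in> D") auto
    qed (use z sp in \<open>auto simp: space_PiM PiE_iff\<close>)
    have TA: "T -` A \<inter> space (PiM D L) \<in> sets (PiM D L)"
      using measurable_compose[OF T AL] by (simp add: pred_def Int_def conj_commute)
    have "emeasure (PiM D L) (T -` A \<inter> space (PiM D L)) =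
        emeasure (distr (PiM UNIV L) (PiM D L) (\<lambda>x. restrict x D)) (T -` A \<inter> space (PiM D L))"
      using \<open>finite D\<close> by (simp add: distr_PiM_restrict_finite)
    also have "\<dots> = emeasure (PiM UNIV L)
        ((\<lambda>x. restrict x D) -` (T -` A \<inter> space (PiM D L)) \<inter> space (PiM UNIV L))"
      by (intro emeasure_distr measurable_restrict_subset TA) auto
    also have "(\<lambda>x. restrict x D) -` (T -` A \<inter> space (PiM D L)) \<inter> space (PiM UNIV L) =
        {x \<in> space (PiM UNIV L). x \<in> A}"
    proof -
      have "T (restrict x D) \<in> A \<longleftrightarrow> x \<in> A" for x
        by (rule A_cong) (simp add: T_def)
      then show ?thesis
        by (auto simp: space_PiM PiE_iff)
    qed
    finally show ?thesis by simp
  qed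
  have "PiM D N = PiM D N'" using eq by (intro PiM_cong) auto
  then show ?thesis using proj[of N] proj[of N'] prob sets by (simp add: measure_def)
qed

text \<open>A bound of Donsker-Varadhan type with \<open>a\<close> times the indicator of
  \<open>A\<close> as test function. The sum is the expected log-likelihood ratio of what is seen.
  The parameter \<open>a\<close> stays free, to be tuned against the error probability.\<close>

lemma change_of_measure_bound:
  fixes N N' :: "'i \<Rightarrow> 'a measure" and r :: "'i \<Rightarrow> 'a \<Rightarrow> real" and a :: real
  assumes J: "finite J"
    and prob: "\<And>k. prob_space (N k)" "\<And>k. prob_space (N' k)"
    and sets: "\<And>k. sets (N k) = sets (N' k)"
    and dens: "\<And>i. i \<in> J \<Longrightarrow> N i = density (N' i) (\<lambda>y. ennreal (r i y))"
    and same: "\<And>k. k \<notin> J \<Longrightarrow> N k = N' k"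
    and r_meas: "\<And>i. i \<in> J \<Longrightarrow> r i \<in> borel_measurable (N' i)"
    and r_pos: "\<And>i y. i \<in> J \<Longrightarrow> 0 < r i y"
    and ln_int: "\<And>i. i \<in> J \<Longrightarrow> integrable (N' i) (\<lambda>y. ln (r i y))"
    and B: "\<And>i. i \<in> J \<Longrightarrow> Measurable.pred (PiM UNIV N') (\<lambda>x. x \<in> B i)"
    and B_upd: "\<And>i x y. i \<in> J \<Longrightarrow> x(i := y) \<in> B i \<longleftrightarrow> x \<in> B i"
    and B_upd': "\<And>i k x y. i \<in> J \<Longrightarrow> k \<in> J \<Longrightarrow> x \<notin> B i \<Longrightarrow> x(i := y) \<in> B k \<longleftrightarrow> x \<in> B k"
    and A[measurable]: "Measurable.pred (PiM UNIV N') (\<lambda>x. x \<in> A)"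
    and A_upd: "\<And>i x y. i \<in> J \<Longrightarrow> x \<notin> B i \<Longrightarrow> x(i := y) \<in> A \<longleftrightarrow> x \<in> A"
  shows "a * \<P>(x in PiM UNIV N'. x \<in> A) \<le>
    (\<Sum>i\<in>J. \<P>(x in PiM UNIV N'. x \<in> B i) * - (\<integral>y. ln (r i y) \<partial>N' i))
      + (exp a - 1) * \<P>(x in PiM UNIV N. x \<in> A)"
proof -
  let ?P = "PiM UNIV N" and ?P' = "PiM UNIV N'"
  interpret P: prob_space ?P by (intro prob_space_PiM prob)
  interpret P': prob_space ?P' by (intro prob_space_PiM prob)
  have setsP: "sets ?P = sets ?P'" by (intro sets_PiM_cong sets refl)
  have A_P[measurable]: "Measurable.pred ?P (\<lambda>x. x \<in> A)"
    using A by (simp add: measurable_cong_sets[OF setsP refl])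
  have ind_int: "integrable ?P (\<lambda>x. indicator A x :: real)" "integrable ?P' (\<lambda>x. indicator A x :: real)"
    by (auto intro!: P.integrable_const_bound[where B=1] P'.integrable_const_bound[where B=1]
        simp: indicator_def)
  have ind: "A \<inter> space ?P = {x \<in> space ?P. x \<in> A}" "A \<inter> space ?P' = {x \<in> space ?P'. x \<in> A}"
    by auto
  \<comment> \<open>\<open>G x\<close> equals \<open>exp (a * indicator A x)\<close>; the form
    affine in the indicator makes its integral immediate.\<close>
  define G :: "('i \<Rightarrow> 'a) \<Rightarrow> real" where "G x = 1 + (exp a - 1) * indicator A x" for x
  define W where "W x = (\<Prod>i\<in>J. if x \<in> B i then r i (x i) else 1)" for x
  define h where "h x = 1 + (\<Sum>i\<in>J. indicator (B i) x * ln (r i (x i))) + a * indicator A x" for x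
  have G_pos: "G x > 0" for x by (simp add: G_def split: split_indicator)
  have W_pos: "W x > 0" for x unfolding W_def using r_pos by (intro prod_pos) auto
  have G_meas[measurable]: "G \<in> borel_measurable ?P'" unfolding G_def[abs_def] by measurable
  have W_meas[measurable]: "W \<in> borel_measurable ?P'"
    unfolding W_def[abs_def]
  proof (rule borel_measurable_prod)
    fix i assume "i \<in> J"
    then have [measurable]: "r i \<in> borel_measurable (N' i)" "Measurable.pred ?P' (\<lambda>x. x \<in> B i)"
      using r_meas B by auto
    show "(\<lambda>x. if x \<in> B i then r i (x i) else 1) \<in> borel_measurable ?P'" by measurable
  qed
  have N_eq: "(\<lambda>k. if k \<in> J then N' k else N k) = N'" using same by auto
  have "(\<integral>\<^sup>+x. ennreal (G x) \<partial>?P) =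
      (\<integral>\<^sup>+x. ennreal (G x) * (\<Prod>i\<in>J. if x \<in> B i then ennreal (r i (x i)) else 1) \<partial>?P')"
    using nn_integral_PiM_swap_coordinates[where N=N and N'=N', OF J prob sets, where B=B and F="\<lambda>x. ennreal (G x)"
        and r="\<lambda>i y. ennreal (r i y)", unfolded N_eq] dens r_meas B B_upd B_upd' A_upd
    by (simp add: G_def indicator_def)
  also have "\<dots> = (\<integral>\<^sup>+x. ennreal (G x * W x) \<partial>?P')"
  proof (intro nn_integral_cong)
    fix x
    have "(\<Prod>i\<in>J. if x \<in> B i then ennreal (r i (x i)) else 1) = ennreal (W x)"
      unfolding W_def using r_pos
      by (subst prod_ennreal[symmetric]) (auto intro!: prod.cong less_imp_le)
    then show "ennreal (G x) * (\<Prod>i\<in>J. if x \<in> B i then ennreal (r i (x i)) else 1) =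
        ennreal (G x * W x)"
      using G_pos W_pos by (simp add: ennreal_mult less_imp_le)
  qed
  finally have swap: "(\<integral>\<^sup>+x. ennreal (G x * W x) \<partial>?P') = (\<integral>\<^sup>+x. ennreal (G x) \<partial>?P)" ..
  have G_int: "integrable ?P G" unfolding G_def[abs_def] using ind_int by simp
  \<comment> \<open>\<open>W\<close> has no a priori bound, so finiteness is read off from the
    exchange, whose other side is the integral of the bounded \<open>G\<close>.\<close>
  have GW_int: "integrable ?P' (\<lambda>x. G x * W x)"
  proof (rule integrableI_nonneg)
    show "(\<integral>\<^sup>+x. ennreal (G x * W x) \<partial>?P') < \<infinity>"
      unfolding swap using G_int G_pos by (simp add: nn_integral_eq_integral less_imp_le)
  qed (use G_pos W_pos in \<open>auto simp: less_imp_le\<close>)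
  have "(\<integral>x. G x * W x \<partial>?P') = (\<integral>x. G x \<partial>?P)"
    by (subst (1 2) integral_eq_nn_integral)
      (use G_pos W_pos G_int in \<open>auto simp: swap less_imp_le\<close>)
  also have "\<dots> = 1 + (exp a - 1) * \<P>(x in ?P. x \<in> A)"
    unfolding G_def[abs_def] using ind_int by (simp add: P.prob_space ind)
  finally have GW: "(\<integral>x. G x * W x \<partial>?P') = 1 + (exp a - 1) * \<P>(x in ?P. x \<in> A)" .
  note term_int = integrable_PiM_indicator_component[OF prob(2) ln_int B B_upd]
    and term_eq = integral_PiM_indicator_component[OF prob(2) ln_int B B_upd]
  have h_int: "integrable ?P' h"
    unfolding h_def[abs_def] using term_int ind_int by auto
  have "(\<integral>x. h x \<partial>?P') =
      1 + (\<Sum>i\<in>J. \<P>(x in ?P'. x \<in> B i) * (\<integral>y. ln (r i y) \<partial>N' i)) + a * \<P>(x in ?P'. x \<in> A)"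
    unfolding h_def[abs_def] using term_int ind_int by (simp add: P'.prob_space term_eq ind)
  \<comment> \<open>\<open>h\<close> is 1 plus the logarithm of \<open>G * W\<close>, so Jensen's inequality reduces to \<open>ln z \<le> z - 1\<close>.\<close>
  moreover have "(\<integral>x. h x \<partial>?P') \<le> (\<integral>x. G x * W x \<partial>?P')"
  proof (intro integral_mono h_int GW_int)
    fix x
    have "ln (W x) = (\<Sum>i\<in>J. ln (if x \<in> B i then r i (x i) else 1))"
      unfolding W_def using r_pos[THEN less_imp_neq, THEN not_sym]
      by (intro ln_prod J) auto
    also have "\<dots> = (\<Sum>i\<in>J. indicator (B i) x * ln (r i (x i)))"
      by (intro sum.cong) auto
    finally have "ln (G x * W x) = h x - 1"
      using G_pos[of x] W_pos[of x]
      by (simp add: ln_mult h_def) (simp add: G_def split: split_indicator)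
    moreover have "ln (G x * W x) \<le> G x * W x - 1"
      using G_pos W_pos by (intro ln_le_minus_one mult_pos_pos)
    ultimately show "h x \<le> G x * W x" by simp
  qed
  ultimately show ?thesis by (simp add: GW sum_negf)
qed

section \<open>Influence of single observations on a policy\<close>

text \<open>The observation with time index \<open>t\<close> is first appended in the history of
  length \<open>Suc t\<close>, hence \<open>n \<le> t\<close> and not only \<open>n < t\<close>. If
  its cell is not selected at time \<open>t\<close>, it is never recorded.\<close>

lemma hist_fun_upd:
  assumes "n \<le> t \<or> i \<notin> sel P u (hist P u x t)"
  shows "hist P u (x((t, i) := v)) n = hist P u x n"
  using assms
proof (induction n)
  case (Suc n)
  have IH: "hist P u (x((t, i) := v)) n = hist P u x n"
    using Suc.prems by (intro Suc.IH) auto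
  have "restrict (\<lambda>k. (x((t, i) := v)) (n, k)) (sel P u (hist P u x n)) =
      restrict (\<lambda>k. x (n, k)) (sel P u (hist P u x n))"
    using Suc.prems by (intro restrict_ext) auto
  then show ?case by (simp only: hist.simps IH Let_def)
qed simp

lemma hist_cong:
  assumes "\<And>t i. t < n \<Longrightarrow> i \<in> C \<Longrightarrow> x (t, i) = y (t, i)" and "\<And>h. sel P u h \<subseteq> C"
  shows "hist P u x n = hist P u y n"
  using assms(1)
proof (induction n)
  case (Suc n)
  then have IH: "hist P u x n = hist P u y n" by auto
  have "restrict (\<lambda>k. x (n, k)) (sel P u (hist P u y n)) =
      restrict (\<lambda>k. y (n, k)) (sel P u (hist P u y n))"
    using Suc.prems assms(2) by (intro restrict_ext) blast
  then show ?case by (simp only: hist.simps IH Let_def)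
qed simp

text \<open>Stopping at \<open>t\<close> itself is excluded too, so this is the event that the
  stopping time exceeds \<open>t\<close> and the observations with index \<open>t\<close> are
  taken.\<close>

definition running :: "'a policy \<Rightarrow> real \<Rightarrow> (nat \<times> nat \<Rightarrow> 'a) \<Rightarrow> nat \<Rightarrow> bool" where
  "running P u x t \<longleftrightarrow> (\<forall>s\<le>t. \<not> stp P u (hist P u x s))"

text \<open>\<open>hist\<close> keeps growing after the policy has stopped; the first conjunct
  discards selections made from then on.\<close>

definition observed :: "'a policy \<Rightarrow> real \<Rightarrow> nat \<times> nat \<Rightarrow> (nat \<times> nat \<Rightarrow> 'a) set" where
  "observed P u ti = {x. running P u x (fst ti) \<and> snd ti \<in> sel P u (hist P u x (fst ti))}"

text \<open>The horizon \<open>n\<close> makes the event depend on finitely many times, which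
  permits a finite exchange of laws; a limit removes it later.\<close>

definition decided_by :: "'a policy \<Rightarrow> real \<Rightarrow> nat \<Rightarrow> nat \<Rightarrow> (nat \<times> nat \<Rightarrow> 'a) set" where
  "decided_by P u m n =
    {x. \<exists>t\<le>n. stp P u (hist P u x t) \<and> (\<forall>s<t. \<not> stp P u (hist P u x s)) \<and> dec P u (hist P u x t) = m}"

text \<open>Predictability: stopping and selection up to this time consult only histories that do
  not yet contain the observation.\<close>

lemma observed_fun_upd_self: "x(ti := v) \<in> observed P u ti \<longleftrightarrow> x \<in> observed P u ti"
  by (cases ti) (simp add: observed_def running_def hist_fun_upd)

text \<open>An observation is missing for one of two reasons. Either its cell is not selected, and
  no history contains it, or the policy has stopped at some \<open>s\<close>; then histories beyond
  \<open>s\<close> may change, but they no longer matter.\<close>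

lemma unobserved_cases:
  assumes "x \<notin> observed P u (t, i)"
  obtains "\<And>v n. hist P u (x((t, i) := v)) n = hist P u x n"
  | s where "s \<le> t" "stp P u (hist P u x s)"
    "\<And>v n. n \<le> s \<Longrightarrow> hist P u (x((t, i) := v)) n = hist P u x n"
proof (cases "i \<in> sel P u (hist P u x t)")
  case False
  then show ?thesis using that(1) by (simp add: hist_fun_upd)
next
  case True
  then obtain s where "s \<le> t" "stp P u (hist P u x s)"
    using assms by (auto simp: observed_def running_def)
  then show ?thesis using that(2) by (simp add: hist_fun_upd)
qed

lemma observed_fun_upd:
  assumes "x \<notin> observed P u ti"
  shows "x(ti := v) \<in> observed P u sk \<longleftrightarrow> x \<in> observed P u sk"
proof -
  obtain t i where ti: "ti = (t, i)" by (cases ti)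
  from assms[unfolded ti] show ?thesis
  proof (cases rule: unobserved_cases)
    case 1
    then show ?thesis by (simp add: ti observed_def running_def)
  next
    case (2 s)
    \<comment> \<open>The stop at \<open>s\<close> survives the update, so from \<open>s\<close> on
      neither point is still running.\<close>
    then have stop: "stp P u (hist P u (x((t, i) := v)) s)" by simp
    show ?thesis
    proof (cases "fst sk \<le> s")
      case True
      then show ?thesis using 2 by (auto simp: ti observed_def running_def)
    next
      case False
      then have "s \<le> fst sk" by simp
      then show ?thesis using 2 stop by (auto simp: ti observed_def running_def)
    qed
  qed
qed

lemma decided_by_fun_upd:
  assumes "x \<notin> observed P u ti"
  shows "x(ti := v) \<in> decided_by P u m n \<longleftrightarrow> x \<in> decided_by P u m n"
proof -
  obtain t i where ti: "ti = (t, i)" by (cases ti)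
  from assms[unfolded ti] show ?thesis
  proof (cases rule: unobserved_cases)
    case 1
    then show ?thesis by (simp add: ti decided_by_def)
  next
    case (2 s)
    \<comment> \<open>After a stop at \<open>s\<close>, a first stopping time is at most
      \<open>s\<close> and involves unchanged histories only.\<close>
    have "stp P u (hist P u z k) \<and> (\<forall>l<k. \<not> stp P u (hist P u z l)) \<longrightarrow> k \<le> s"
      if "stp P u (hist P u z s)" for z k
      using that by (meson not_le)
    moreover have "hist P u (x((t, i) := v)) s = hist P u x s" using 2 by simp
    ultimately show ?thesis
      unfolding ti decided_by_def using 2
      by (smt (verit, best) mem_Collect_eq order.strict_implies_order order_trans)
  qed
qed

lemma decided_by_cong:
  assumes "\<And>t i. t < n \<Longrightarrow> i \<in> C \<Longrightarrow> x (t, i) = y (t, i)" and "\<And>h. sel P u h \<subseteq> C"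
  shows "x \<in> decided_by P u m n \<longleftrightarrow> y \<in> decided_by P u m n"
proof -
  have "hist P u x t = hist P u y t" if "t \<le> n" for t
    using that assms by (intro hist_cong[of t C]) auto
  then show ?thesis
    by (auto simp: decided_by_def)
qed

lemma
  assumes adm: "admissible M K \<mu> P"
  shows pred_running: "Measurable.pred (sample_space \<mu>) (\<lambda>(u, x). running P u x t)"
    and pred_observed: "Measurable.pred (sample_space \<mu>) (\<lambda>(u, x). x \<in> observed P u ti)"
    and pred_decided_by: "Measurable.pred (sample_space \<mu>) (\<lambda>(u, x). x \<in> decided_by P u m n)"
proof -
  have stp[measurable]:
    "Measurable.pred (sample_space \<mu>) (\<lambda>\<omega>. stp P (fst \<omega>) (hist P (fst \<omega>) (snd \<omega>) s))" for s
    using adm by (simp add: admissible_def split_beta')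
  have sel: "(\<lambda>\<omega>. sel P (fst \<omega>) (hist P (fst \<omega>) (snd \<omega>) s)) \<in> sample_space \<mu> \<rightarrow>\<^sub>M count_space UNIV" for s
    using adm by (simp add: admissible_def split_beta')
  have dec: "(\<lambda>\<omega>. dec P (fst \<omega>) (hist P (fst \<omega>) (snd \<omega>) s)) \<in> sample_space \<mu> \<rightarrow>\<^sub>M count_space UNIV" for s
    using adm by (simp add: admissible_def split_beta')
  have [measurable]:
    "Measurable.pred (sample_space \<mu>) (\<lambda>\<omega>. k \<in> sel P (fst \<omega>) (hist P (fst \<omega>) (snd \<omega>) s))" for k s
    using measurable_compose[OF sel, of "\<lambda>S. k \<in> S"] by simp
  have [measurable]:
    "Measurable.pred (sample_space \<mu>) (\<lambda>\<omega>. dec P (fst \<omega>) (hist P (fst \<omega>) (snd \<omega>) s) = k)" for k s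
    using measurable_compose[OF dec, of "\<lambda>i. i = k"] by simp
  show "Measurable.pred (sample_space \<mu>) (\<lambda>(u, x). running P u x t)"
    unfolding running_def split_beta' by measurable
  then have [measurable]: "Measurable.pred (sample_space \<mu>) (\<lambda>\<omega>. running P (fst \<omega>) (snd \<omega>) s)" for s
    unfolding running_def split_beta' by measurable
  show "Measurable.pred (sample_space \<mu>) (\<lambda>(u, x). x \<in> observed P u ti)"
    unfolding observed_def split_beta' mem_Collect_eq by measurable
  show "Measurable.pred (sample_space \<mu>) (\<lambda>(u, x). x \<in> decided_by P u m n)"
    unfolding decided_by_def split_beta' mem_Collect_eq by measurable
qed

section \<open>The search model\<close>

locale search_model =
  fixes \<mu> :: "'a measure" and f g :: "'a \<Rightarrow> real"
  assumes f_meas[measurable]: "f \<in> borel_measurable \<mu>" and f_nn: "f y \<ge> 0"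
    and f_int: "(\<integral>\<^sup>+ y. ennreal (f y) \<partial>\<mu>) = 1"
    and g_meas[measurable]: "g \<in> borel_measurable \<mu>" and g_nn: "g y \<ge> 0"
    and g_int: "(\<integral>\<^sup>+ y. ennreal (g y) \<partial>\<mu>) = 1"
    and abs_cont: "AE y in \<mu>. (f y > 0 \<longleftrightarrow> g y > 0)"
    and int_gf: "integrable \<mu> (\<lambda>y. g y * ln (g y / f y))"
    and int_fg: "integrable \<mu> (\<lambda>y. f y * ln (f y / g y))"
begin

text \<open>Where \<open>f\<close> or \<open>g\<close> vanishes, a null set under both laws, the value 1 keeps the ratio positive.\<close>

definition lr :: "'a \<Rightarrow> real" where
  "lr y = (if f y > 0 \<and> g y > 0 then f y / g y else 1)"

lemma lr_pos: "lr y > 0" by (simp add: lr_def)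

lemma lr_meas[measurable]: "lr \<in> borel_measurable \<mu>"
  unfolding lr_def[abs_def] by measurable

text \<open>By \<open>abs_cont\<close> the densities vanish together almost everywhere; where they
  do, both sides are 0, and elsewhere \<open>lr\<close> is the quotient
  \<open>f / g\<close>.\<close>

lemma density_f_eq: "density \<mu> (\<lambda>y. ennreal (f y)) =
    density (density \<mu> (\<lambda>y. ennreal (g y))) (\<lambda>y. ennreal (lr y))"
proof -
  have "AE y in \<mu>. ennreal (f y) = ennreal (g y) * ennreal (lr y)"
    using abs_cont
  proof eventually_elim
    case (elim y)
    then show ?case using f_nn[of y] g_nn[of y]
      by (auto simp: ennreal_mult[symmetric] lr_def less_le)
  qed
  then show ?thesis by (subst density_density_eq) (auto intro!: density_cong)
qed

lemma density_g_eq: "density \<mu> (\<lambda>y. ennreal (g y)) =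
    density (density \<mu> (\<lambda>y. ennreal (f y))) (\<lambda>y. ennreal (inverse (lr y)))"
proof -
  have "AE y in \<mu>. ennreal (g y) = ennreal (f y) * ennreal (inverse (lr y))"
    using abs_cont
  proof eventually_elim
    case (elim y)
    then show ?case using f_nn[of y] g_nn[of y]
      by (auto simp: ennreal_mult[symmetric] lr_def less_le)
  qed
  then show ?thesis by (subst density_density_eq) (auto intro!: density_cong)
qed

text \<open>The sign is reversed because \<open>lr\<close> is \<open>f / g\<close> while the
  divergence averages the logarithm of \<open>g / f\<close>. The default value 1 of
  \<open>lr\<close> has logarithm 0.\<close>

lemma
  shows integrable_ln_lr: "integrable (density \<mu> (\<lambda>y. ennreal (g y))) (\<lambda>y. ln (lr y))"
    and integral_ln_lr: "(\<integral>y. ln (lr y) \<partial>density \<mu> (\<lambda>y. ennreal (g y))) = - KLdiv \<mu> g f"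
proof -
  have e: "AE y in \<mu>. g y * ln (lr y) = - (g y * ln (g y / f y))"
    using abs_cont
  proof eventually_elim
    case (elim y)
    then show ?case using f_nn[of y] g_nn[of y]
      by (auto simp: lr_def less_le ln_div right_diff_distrib)
  qed
  have "integrable \<mu> (\<lambda>y. g y * ln (lr y))"
    using int_gf by (subst integrable_cong_AE[OF _ _ e]) auto
  then show "integrable (density \<mu> (\<lambda>y. ennreal (g y))) (\<lambda>y. ln (lr y))"
    using g_nn by (subst integrable_density) auto
  have "(\<integral>y. g y * ln (lr y) \<partial>\<mu>) = - KLdiv \<mu> g f"
    by (subst integral_cong_AE[OF _ _ e]) (auto simp: KLdiv_def)
  then show "(\<integral>y. ln (lr y) \<partial>density \<mu> (\<lambda>y. ennreal (g y))) = - KLdiv \<mu> g f"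
    using g_nn by (subst integral_density) auto
qed

lemma
  shows integrable_ln_inverse_lr:
      "integrable (density \<mu> (\<lambda>y. ennreal (f y))) (\<lambda>y. ln (inverse (lr y)))"
    and integral_ln_inverse_lr:
      "(\<integral>y. ln (inverse (lr y)) \<partial>density \<mu> (\<lambda>y. ennreal (f y))) = - KLdiv \<mu> f g"
proof -
  have e: "AE y in \<mu>. f y * ln (inverse (lr y)) = - (f y * ln (f y / g y))"
    using abs_cont
  proof eventually_elim
    case (elim y)
    then show ?case using f_nn[of y] g_nn[of y]
      by (auto simp: lr_def less_le ln_div right_diff_distrib)
  qed
  have "integrable \<mu> (\<lambda>y. f y * ln (inverse (lr y)))"
    using int_fg by (subst integrable_cong_AE[OF _ _ e]) auto
  then show "integrable (density \<mu> (\<lambda>y. ennreal (f y))) (\<lambda>y. ln (inverse (lr y)))"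
    using f_nn by (subst integrable_density) auto
  have "(\<integral>y. f y * ln (inverse (lr y)) \<partial>\<mu>) = - KLdiv \<mu> f g"
    by (subst integral_cong_AE[OF _ _ e]) (auto simp: KLdiv_def)
  then show "(\<integral>y. ln (inverse (lr y)) \<partial>density \<mu> (\<lambda>y. ennreal (f y))) = - KLdiv \<mu> f g"
    using f_nn by (subst integral_density) auto
qed

abbreviation cell_law :: "nat \<Rightarrow> nat \<times> nat \<Rightarrow> 'a measure" where
  "cell_law j ni \<equiv> density \<mu> (\<lambda>y. ennreal (if snd ni = j then g y else f y))"

abbreviation obs_law :: "nat \<Rightarrow> (nat \<times> nat \<Rightarrow> 'a) measure" where
  "obs_law j \<equiv> PiM UNIV (cell_law j)"

lemma prob_space_cell_law: "prob_space (cell_law j ni)"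
  by (rule prob_spaceI, cases "snd ni = j") (auto simp: emeasure_density f_int g_int cong: nn_integral_cong_simp)

lemma prob_space_obs_law: "prob_space (obs_law j)"
  by (intro prob_space_PiM prob_space_cell_law)

lemma sets_obs_law: "sets (obs_law j) = sets (PiM UNIV (\<lambda>_ :: nat \<times> nat. \<mu>))"
  by (intro sets_PiM_cong) auto

lemma Pm_eq: "Pm \<mu> f g j = uniform_measure lborel {0..1} \<Otimes>\<^sub>M obs_law j"
  by (simp add: Pm_def)

lemma sets_Pm: "sets (Pm \<mu> f g j) = sets (sample_space \<mu>)"
  unfolding Pm_eq sample_space_def using sets_obs_law by (rule sets_pair_measure_cong[OF refl])

text \<open>Fixing the seed makes the policy deterministic; joint measurability passes to the
  sections.\<close>

lemma pred_section:
  assumes "Measurable.pred (sample_space \<mu>) (\<lambda>(u, x). Q u x)"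
  shows "Measurable.pred (obs_law j) (Q u)"
proof -
  have "Measurable.pred (PiM UNIV (\<lambda>_. \<mu>)) (\<lambda>x. case (u, x) of (u, x) \<Rightarrow> Q u x)"
    using assms unfolding sample_space_def by (rule measurable_Pair2) simp
  then show ?thesis
    by (subst measurable_cong_sets[OF sets_obs_law refl]) simp
qed

lemma two_hypotheses_bound:
  assumes adm: "admissible M K \<mu> P" and m: "m \<in> {1..M}" and j: "j \<in> {1..M}" "j \<noteq> m"
  shows "a * \<P>(x in obs_law m. x \<in> decided_by P u m n) \<le>
    (\<Sum>t<n. \<P>(x in obs_law m. x \<in> observed P u (t, m)) * KLdiv \<mu> g f
         + \<P>(x in obs_law m. x \<in> observed P u (t, j)) * KLdiv \<mu> f g)
    + (exp a - 1) * \<P>(x in obs_law j. x \<in> decided_by P u m n)"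
proof -
  define J where "J = {..<n} \<times> {m, j}"
  \<comment> \<open>A hybrid law: \<open>H\<^sub>j\<close> at the first \<open>n\<close> times,
    \<open>H\<^sub>m\<close> afterwards. Only finitely many laws are exchanged, and by
    \<open>tail\<close> the truncated event cannot tell the hybrid from
    \<open>H\<^sub>j\<close>.\<close>
  define N where "N k = (if k \<in> J then cell_law j k else cell_law m k)" for k
  \<comment> \<open>The density of \<open>H\<^sub>j\<close> relative to \<open>H\<^sub>m\<close>:
    \<open>f / g\<close> at cell \<open>m\<close> and \<open>g / f\<close> at cell
    \<open>j\<close>.\<close>
  define r where "r k y = (if snd k = m then lr y else inverse (lr y))" for k :: "nat \<times> nat" and y
  have sel: "sel P u h \<subseteq> {1..M}" for h using adm by (simp add: admissible_def)
  note decided = pred_section[OF pred_decided_by[OF adm]]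
  have probN: "prob_space (N k)" for k by (simp add: N_def prob_space_cell_law)
  have tail: "\<P>(x in obs_law j. x \<in> decided_by P u m n) = \<P>(x in PiM UNIV N. x \<in> decided_by P u m n)"
  proof (rule prob_PiM_cong_coordinates)
    show "cell_law j k = N k" if "k \<in> {..<n} \<times> {1..M}" for k
      using that by (cases "snd k = j") (auto simp: N_def J_def)
    show "x \<in> decided_by P u m n \<longleftrightarrow> y \<in> decided_by P u m n"
      if "\<And>k. k \<in> {..<n} \<times> {1..M} \<Longrightarrow> x k = y k" for x y
      using that sel by (intro decided_by_cong[where C="{1..M}"]) auto
  qed (auto simp: prob_space_cell_law probN N_def intro!: decided)
  have cell_m: "cell_law m k = density \<mu> (\<lambda>y. ennreal (g y))"
    "cell_law j k = density \<mu> (\<lambda>y. ennreal (f y))" if "snd k = m" for k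
    using that j by auto
  have cell_j: "cell_law m k = density \<mu> (\<lambda>y. ennreal (f y))"
    "cell_law j k = density \<mu> (\<lambda>y. ennreal (g y))" if "snd k = j" for k
    using that j by auto
  have snd_J: "snd k = m \<or> snd k = j" if "k \<in> J" for k using that by (auto simp: J_def)
  have r_m: "r k = lr" if "snd k = m" for k using that by (auto simp: r_def)
  have r_j: "r k = (\<lambda>y. inverse (lr y))" if "snd k = j" for k using that j by (auto simp: r_def)
  have "a * \<P>(x in obs_law m. x \<in> decided_by P u m n) \<le>
      (\<Sum>k\<in>J. \<P>(x in obs_law m. x \<in> observed P u k) * - (\<integral>y. ln (r k y) \<partial>cell_law m k))
      + (exp a - 1) * \<P>(x in PiM UNIV N. x \<in> decided_by P u m n)"
  proof (rule change_of_measure_bound)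
    show "finite J" by (simp add: J_def)
    show "N k = density (cell_law m k) (\<lambda>y. ennreal (r k y))" if "k \<in> J" for k
      using snd_J[OF that]
    proof
      assume k: "snd k = m"
      show ?thesis unfolding N_def r_m[OF k] cell_m[OF k] using that density_f_eq by simp
    next
      assume k: "snd k = j"
      show ?thesis unfolding N_def r_j[OF k] cell_j[OF k] using that density_g_eq by simp
    qed
    show "integrable (cell_law m k) (\<lambda>y. ln (r k y))" if "k \<in> J" for k
      using snd_J[OF that]
    proof
      assume k: "snd k = m"
      show ?thesis unfolding r_m[OF k] cell_m[OF k] by (rule integrable_ln_lr)
    next
      assume k: "snd k = j"
      show ?thesis unfolding r_j[OF k] cell_j[OF k] by (rule integrable_ln_inverse_lr)
    qed
    show "r k \<in> borel_measurable (cell_law m k)" for k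
      unfolding r_def by measurable
    show "0 < r k y" for k y by (simp add: r_def lr_pos)
    show "Measurable.pred (obs_law m) (\<lambda>x. x \<in> observed P u k)" for k
      by (rule pred_section[OF pred_observed[OF adm]])
  qed (auto simp: prob_space_cell_law probN N_def intro!: decided
      simp: observed_fun_upd_self observed_fun_upd decided_by_fun_upd)
  also have "(\<Sum>k\<in>J. \<P>(x in obs_law m. x \<in> observed P u k) * - (\<integral>y. ln (r k y) \<partial>cell_law m k)) =
      (\<Sum>t<n. \<P>(x in obs_law m. x \<in> observed P u (t, m)) * KLdiv \<mu> g f
         + \<P>(x in obs_law m. x \<in> observed P u (t, j)) * KLdiv \<mu> f g)"
    unfolding J_def sum.cartesian_product' using j
    by (simp add: r_m r_j integral_ln_lr integral_ln_inverse_lr)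
  finally show ?thesis by (simp add: tail)
qed

end

section \<open>Information gained in one time step\<close>

text \<open>Summed over the \<open>M - 1\<close> alternatives, a selection containing
  \<open>m\<close> yields \<open>M - 1\<close> times \<open>Dgf\<close> plus \<open>K - 1\<close>
  times \<open>Dfg\<close>; one missing \<open>m\<close> yields \<open>K\<close> times
  \<open>Dfg\<close>. Divided by \<open>M - 1\<close> these are the two entries of the maximum in
  \<open>Istar\<close>.\<close>

lemma Istar_budget:
  assumes "2 \<le> M" and "m \<in> {1..M}" and S: "S \<subseteq> {1..M}" "card S = K"
  shows "real (M - 1) * of_bool (m \<in> S) * Dgf + (\<Sum>j\<in>{1..M} - {m}. of_bool (j \<in> S)) * Dfg
    \<le> real (M - 1) * Istar M K Dgf Dfg"
proof -
  have fin: "finite S" using S finite_subset by blast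
  have M1: "real (M - 1) = real M - 1" "real M - 1 > 0" using assms by auto
  have "(\<Sum>j\<in>{1..M} - {m}. of_bool (j \<in> S) :: real) = real (card (({1..M} - {m}) \<inter> S))"
    by simp
  also have "({1..M} - {m}) \<inter> S = S - {m}" using S by auto
  also have "real (card (S - {m})) = real K - of_bool (m \<in> S)"
  proof (cases "m \<in> S")
    case True
    then have "card S > 0" using fin by (auto simp: card_gt_0_iff)
    then show ?thesis using True S by (simp add: card_Diff_singleton of_nat_diff)
  qed (use S in simp)
  finally have count: "(\<Sum>j\<in>{1..M} - {m}. of_bool (j \<in> S) :: real) = real K - of_bool (m \<in> S)" .
  show ?thesis
  proof (cases "K = M")
    case True
    \<comment> \<open>All cells are selected, so \<open>m\<close> cannot be missed and only one of
      the two cases is left.\<close>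
    then have "S = {1..M}" using S by (intro card_subset_eq) auto
    then show ?thesis
      using assms True unfolding count M1 by (simp add: Istar_def algebra_simps)
  next
    case False
    have I: "real K * Dfg / (real M - 1) \<le> Istar M K Dgf Dfg"
      "Dgf + (real K - 1) * Dfg / (real M - 1) \<le> Istar M K Dgf Dfg"
      using False by (auto simp: Istar_def)
    show ?thesis
      using I[THEN mult_left_mono, OF less_imp_le[OF M1(2)]]
      using M1 unfolding count M1 by (cases "m \<in> S") (auto simp: distrib_left)
  qed
qed

lemma running_iff: "running P u x t \<longleftrightarrow> enat t < stoptime P u x"
proof (cases "\<exists>n. stp P u (hist P u x n)")
  case True
  let ?k = "LEAST n. stp P u (hist P u x n)"
  have "stp P u (hist P u x ?k)" using True by (rule LeastI_ex)
  moreover have "\<not> stp P u (hist P u x s)" if "s < ?k" for s using that by (rule not_less_Least)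
  ultimately show ?thesis
    using True unfolding running_def stoptime_def by (auto simp: not_less) (meson not_le order_trans leD leI)
qed (auto simp: running_def stoptime_def)

text \<open>The complement is the event in \<open>err_prob\<close>, where never stopping counts as
  an error. If a stop exists, the time in \<open>decided_by\<close> can only be the least
  one.\<close>

lemma ex_decided_by_iff:
  "(\<exists>n. x \<in> decided_by P u m n) \<longleftrightarrow> stoptime P u x \<noteq> \<infinity> \<and> decision P u x = m"
proof (cases "\<exists>n. stp P u (hist P u x n)")
  case True
  let ?k = "LEAST n. stp P u (hist P u x n)"
  have k: "stp P u (hist P u x ?k)" using True by (rule LeastI_ex)
  have k': "\<not> stp P u (hist P u x s)" if "s < ?k" for s using that by (rule not_less_Least)
  have first: "stp P u (hist P u x t) \<and> (\<forall>s<t. \<not> stp P u (hist P u x s)) \<longleftrightarrow> t = ?k" for t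
    using k k' by (metis linorder_neqE_nat)
  have "x \<in> decided_by P u m n \<longleftrightarrow> ?k \<le> n \<and> dec P u (hist P u x ?k) = m" for n
  proof -
    have "x \<in> decided_by P u m n \<longleftrightarrow>
        (\<exists>t. (stp P u (hist P u x t) \<and> (\<forall>s<t. \<not> stp P u (hist P u x s))) \<and> t \<le> n \<and> dec P u (hist P u x t) = m)"
      by (auto simp: decided_by_def)
    then show ?thesis unfolding first by simp
  qed
  then show ?thesis using True by (auto simp: stoptime_def decision_def)
qed (auto simp: decided_by_def stoptime_def)

section \<open>Averaging over the alternatives and the seed\<close>

context search_model
begin

text \<open>A policy may favour a single alternative and gain more than \<open>Istar\<close> per
  step against it; only the sum over all alternatives obeys the budget. Hence the bounds for the
  pairs are added up.\<close>

lemma all_hypotheses_bound: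
  assumes adm: "admissible M K \<mu> P" and M: "2 \<le> M" and m: "m \<in> {1..M}"
  shows "real (M - 1) * (a * \<P>(x in obs_law m. x \<in> decided_by P u m n)) \<le>
    real (M - 1) * Istar M K (KLdiv \<mu> g f) (KLdiv \<mu> f g) * (\<Sum>t<n. \<P>(x in obs_law m. running P u x t))
    + (exp a - 1) * (\<Sum>j\<in>{1..M} - {m}. \<P>(x in obs_law j. x \<in> decided_by P u m n))"
proof -
  interpret prob_space "obs_law m" by (rule prob_space_obs_law)
  let ?I = "Istar M K (KLdiv \<mu> g f) (KLdiv \<mu> f g)"
  let ?obs = "\<lambda>t i. \<P>(x in obs_law m. x \<in> observed P u (t, i))"
  note [measurable] = pred_section[OF pred_observed[OF adm]] pred_section[OF pred_running[OF adm]]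
  have p_eq: "\<P>(x in obs_law m. Q x) = (\<integral>x. of_bool (Q x) \<partial>obs_law m)"
    and p_int: "integrable (obs_law m) (\<lambda>x. of_bool (Q x) :: real)"
    if [measurable]: "Measurable.pred (obs_law m) Q" for Q
  proof -
    have e: "(of_bool (Q x) :: real) = indicator {x \<in> space (obs_law m). Q x} x"
      if "x \<in> space (obs_law m)" for x using that by (simp add: indicator_def)
    show "\<P>(x in obs_law m. Q x) = (\<integral>x. of_bool (Q x) \<partial>obs_law m)"
      by (subst Bochner_Integration.integral_cong[OF refl e]) auto
    show "integrable (obs_law m) (\<lambda>x. of_bool (Q x) :: real)"
      by (rule integrable_const_bound[where B=1]) auto
  qed
  \<comment> \<open>The budget holds pointwise while the policy runs, and both sides are 0 after it
    has stopped.\<close>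
  have step: "real (M - 1) * (?obs t m * KLdiv \<mu> g f) + (\<Sum>j\<in>{1..M} - {m}. ?obs t j * KLdiv \<mu> f g)
      \<le> real (M - 1) * ?I * \<P>(x in obs_law m. running P u x t)" for t
  proof -
    define w where "w i x = (of_bool (x \<in> observed P u (t, i)) :: real)" for i x
    have [simp]: "integrable (obs_law m) (w i)" for i
      unfolding w_def[abs_def] by (rule p_int) measurable
    have r_int [simp]: "integrable (obs_law m) (\<lambda>x. of_bool (running P u x t) :: real)"
      by (rule p_int) measurable
    have o_eq: "?obs t i = (\<integral>x. w i x \<partial>obs_law m)" for i
      unfolding w_def by (rule p_eq) measurable
    have r_eq: "\<P>(x in obs_law m. running P u x t) = (\<integral>x. of_bool (running P u x t) \<partial>obs_law m)"
      by (rule p_eq) measurable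
    have "real (M - 1) * (?obs t m * KLdiv \<mu> g f) + (\<Sum>j\<in>{1..M} - {m}. ?obs t j * KLdiv \<mu> f g) =
        (\<integral>x. real (M - 1) * w m x * KLdiv \<mu> g f + (\<Sum>j\<in>{1..M} - {m}. w j x) * KLdiv \<mu> f g \<partial>obs_law m)"
      unfolding o_eq by (simp add: sum_distrib_right)
    also have "\<dots> \<le> (\<integral>x. real (M - 1) * ?I * of_bool (running P u x t) \<partial>obs_law m)"
    proof (intro integral_mono)
      fix x
      show "real (M - 1) * w m x * KLdiv \<mu> g f + (\<Sum>j\<in>{1..M} - {m}. w j x) * KLdiv \<mu> f g
          \<le> real (M - 1) * ?I * of_bool (running P u x t)"
      proof (cases "running P u x t")
        case True
        then have "w i x = of_bool (i \<in> sel P u (hist P u x t))" for i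
          by (simp add: w_def observed_def)
        moreover have "sel P u (hist P u x t) \<subseteq> {1..M}" "card (sel P u (hist P u x t)) = K"
          using adm by (auto simp: admissible_def)
        ultimately show ?thesis
          using Istar_budget[OF M m, of "sel P u (hist P u x t)" K] True by simp
      qed (simp add: w_def observed_def)
    qed simp_all
    also have "\<dots> = real (M - 1) * ?I * \<P>(x in obs_law m. running P u x t)"
      unfolding r_eq by simp
    finally show ?thesis .
  qed
  have "real (M - 1) * (a * \<P>(x in obs_law m. x \<in> decided_by P u m n)) =
      (\<Sum>j\<in>{1..M} - {m}. a * \<P>(x in obs_law m. x \<in> decided_by P u m n))"
    using m by simp
  also have "\<dots> \<le> (\<Sum>j\<in>{1..M} - {m}.
      (\<Sum>t<n. ?obs t m * KLdiv \<mu> g f + ?obs t j * KLdiv \<mu> f g)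
        + (exp a - 1) * \<P>(x in obs_law j. x \<in> decided_by P u m n))"
    by (intro sum_mono two_hypotheses_bound[OF adm m]) auto
  also have "\<dots> = (\<Sum>t<n. real (M - 1) * (?obs t m * KLdiv \<mu> g f) + (\<Sum>j\<in>{1..M} - {m}. ?obs t j * KLdiv \<mu> f g))
        + (exp a - 1) * (\<Sum>j\<in>{1..M} - {m}. \<P>(x in obs_law j. x \<in> decided_by P u m n))"
    using m by (simp add: sum.distrib sum_distrib_left sum.swap[of _ "{..<n}"])
  also have "(\<Sum>t<n. real (M - 1) * (?obs t m * KLdiv \<mu> g f) + (\<Sum>j\<in>{1..M} - {m}. ?obs t j * KLdiv \<mu> f g))
      \<le> (\<Sum>t<n. real (M - 1) * ?I * \<P>(x in obs_law m. running P u x t))"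
    by (intro sum_mono step)
  finally show ?thesis by (simp add: sum_distrib_left)
qed

lemma prob_space_Pm: "prob_space (Pm \<mu> f g j)"
proof -
  interpret U: prob_space "uniform_measure lborel {0..1::real}"
    by (rule prob_space_uniform_measure) auto
  interpret L: prob_space "obs_law j" by (rule prob_space_obs_law)
  interpret pair_prob_space "uniform_measure lborel {0..1::real}" "obs_law j" ..
  show ?thesis unfolding Pm_eq by unfold_locales
qed

lemma
  assumes Q: "Measurable.pred (sample_space \<mu>) (\<lambda>(u, x). Q u x)"
  shows integrable_prob_section:
      "integrable (uniform_measure lborel {0..1}) (\<lambda>u. \<P>(x in obs_law j. Q u x))"
    and prob_Pm: "\<P>((u, x) in Pm \<mu> f g j. Q u x) =
      (\<integral>u. \<P>(x in obs_law j. Q u x) \<partial>uniform_measure lborel {0..1})"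
proof -
  let ?U = "uniform_measure lborel {0..1::real}"
  interpret U: prob_space ?U by (rule prob_space_uniform_measure) auto
  interpret L: prob_space "obs_law j" by (rule prob_space_obs_law)
  let ?X = "{(u, x) \<in> space (?U \<Otimes>\<^sub>M obs_law j). Q u x}"
  have "Measurable.pred (?U \<Otimes>\<^sub>M obs_law j) (\<lambda>(u, x). Q u x)"
    using Q by (subst measurable_cong_sets[OF sets_Pm[unfolded Pm_eq] refl])
  then have X: "?X \<in> sets (?U \<Otimes>\<^sub>M obs_law j)"
    by (simp add: pred_def split_beta')
  have sec: "Pair u -` ?X = {x \<in> space (obs_law j). Q u x}" for u
    by (auto simp: space_pair_measure)
  have [measurable]: "(\<lambda>u. \<P>(x in obs_law j. Q u x)) \<in> borel_measurable ?U"
    using L.measurable_emeasure_Pair[OF X] unfolding sec measure_def by measurable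
  show "integrable ?U (\<lambda>u. \<P>(x in obs_law j. Q u x))"
    by (rule U.integrable_const_bound[where B=1]) auto
  have "\<P>((u, x) in Pm \<mu> f g j. Q u x) = enn2real (\<integral>\<^sup>+u. emeasure (obs_law j) {x \<in> space (obs_law j). Q u x} \<partial>?U)"
    unfolding Pm_eq measure_def L.emeasure_pair_measure_alt[OF X] sec ..
  also have "\<dots> = (\<integral>u. \<P>(x in obs_law j. Q u x) \<partial>?U)"
    by (subst integral_eq_nn_integral) (auto simp: L.emeasure_eq_measure)
  finally show "\<P>((u, x) in Pm \<mu> f g j. Q u x) = (\<integral>u. \<P>(x in obs_law j. Q u x) \<partial>?U)" .
qed

text \<open>The bound for a fixed seed is linear in the probabilities, with the same
  \<open>a\<close> for all seeds, so it survives integration over the seed.\<close>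

lemma randomized_bound:
  assumes adm: "admissible M K \<mu> P" and M: "2 \<le> M" and m: "m \<in> {1..M}"
  shows "real (M - 1) * (a * \<P>((u, x) in Pm \<mu> f g m. x \<in> decided_by P u m n)) \<le>
    real (M - 1) * Istar M K (KLdiv \<mu> g f) (KLdiv \<mu> f g) *
      (\<Sum>t<n. \<P>((u, x) in Pm \<mu> f g m. running P u x t))
    + (exp a - 1) * (\<Sum>j\<in>{1..M} - {m}. \<P>((u, x) in Pm \<mu> f g j. x \<in> decided_by P u m n))"
proof -
  note d_int = integrable_prob_section[OF pred_decided_by[OF adm]]
    and r_int = integrable_prob_section[OF pred_running[OF adm]]
  have "(\<integral>u. real (M - 1) * (a * \<P>(x in obs_law m. x \<in> decided_by P u m n)) \<partial>uniform_measure lborel {0..1}) \<le>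
    (\<integral>u. real (M - 1) * Istar M K (KLdiv \<mu> g f) (KLdiv \<mu> f g) * (\<Sum>t<n. \<P>(x in obs_law m. running P u x t))
      + (exp a - 1) * (\<Sum>j\<in>{1..M} - {m}. \<P>(x in obs_law j. x \<in> decided_by P u m n)) \<partial>uniform_measure lborel {0..1})"
    by (intro integral_mono all_hypotheses_bound[OF adm M m] Bochner_Integration.integrable_add
        integrable_mult_right Bochner_Integration.integrable_sum d_int r_int)
  then show ?thesis
    unfolding prob_Pm[OF pred_decided_by[OF adm]] prob_Pm[OF pred_running[OF adm]]
    using d_int r_int by simp
qed

lemma error_time_tradeoff:
  assumes adm: "admissible M K \<mu> P" and M: "2 \<le> M" and m: "m \<in> {1..M}"
    and I: "0 \<le> Istar M K (KLdiv \<mu> g f) (KLdiv \<mu> f g)"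
    and T: "exp_time \<mu> f g m P = ennreal T" "0 \<le> T"
    and q: "\<And>j. j \<in> {1..M} \<Longrightarrow> err_prob \<mu> f g j P \<le> ennreal q" "0 \<le> q"
    and a: "0 \<le> a"
  shows "a * (1 - q) \<le> Istar M K (KLdiv \<mu> g f) (KLdiv \<mu> f g) * T + exp a * q"
proof -
  let ?I = "Istar M K (KLdiv \<mu> g f) (KLdiv \<mu> f g)"
  let ?P = "Pm \<mu> f g"
  interpret P: prob_space "?P j" for j by (rule prob_space_Pm)
  have pred: "Measurable.pred (?P j) Q" if "Measurable.pred (sample_space \<mu>) Q" for j Q
    using that by (subst measurable_cong_sets[OF sets_Pm refl])
  have dec: "Measurable.pred (?P j) (\<lambda>(u, x). x \<in> decided_by P u i n)" for i j n
    by (rule pred[OF pred_decided_by[OF adm]])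
  define D where "D j n = {(u, x) \<in> space (?P j). x \<in> decided_by P u m n}" for j n
  have D_sets: "D j n \<in> sets (?P j)" for j n
  proof -
    have "Measurable.pred (?P j) (\<lambda>(u, x). x \<in> decided_by P u m n)" by (rule dec)
    then show ?thesis by (simp add: D_def pred_def split_beta')
  qed
  define R where "R t = {(u, x) \<in> space (?P m). running P u x t}" for t
  have R_sets: "R t \<in> sets (?P m)" for t
    using pred[OF pred_running[OF adm, of t], of m] by (simp add: R_def pred_def split_beta')
  \<comment> \<open>Tail-sum formula: the number of running times below \<open>n\<close> is at most
    the stopping time.\<close>
  have time: "(\<Sum>t<n. measure (?P m) (R t)) \<le> T" for n
  proof -
    have "ennreal (\<Sum>t<n. measure (?P m) (R t)) = (\<Sum>t<n. emeasure (?P m) (R t))"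
      by (simp add: P.emeasure_eq_measure)
    also have "\<dots> = (\<integral>\<^sup>+\<omega>. (\<Sum>t<n. indicator (R t) \<omega>) \<partial>?P m)"
      using R_sets by (subst nn_integral_sum) auto
    also have "\<dots> \<le> exp_time \<mu> f g m P"
      unfolding exp_time_def
    proof (intro nn_integral_mono)
      fix \<omega> :: "real \<times> (nat \<times> nat \<Rightarrow> 'a)"
      obtain u x where \<omega>: "\<omega> = (u, x)" by (cases \<omega>)
      have "(\<Sum>t<n. indicator (R t) \<omega> :: ennreal) \<le> (\<Sum>t<n. of_bool (running P u x t))"
        unfolding \<omega> by (intro sum_mono) (auto simp: R_def indicator_def)
      also have "\<dots> = of_nat (card {t \<in> {..<n}. running P u x t})"
        by (simp add: of_bool_def sum.If_cases Int_def)
      also have "\<dots> \<le> ennreal_of_enat (stoptime P u x)"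
      proof (cases "stoptime P u x")
        case (enat k)
        have "card {t \<in> {..<n}. running P u x t} \<le> card {..<k}"
          using enat by (intro card_mono) (auto simp: running_iff)
        then show ?thesis using enat by simp
      qed simp
      finally show "(\<Sum>t<n. indicator (R t) \<omega>)
          \<le> (case \<omega> of (u, x) \<Rightarrow> ennreal_of_enat (stoptime P u x))"
        by (simp add: \<omega>)
    qed
    finally show ?thesis using T by simp
  qed
  \<comment> \<open>Deciding for \<open>m\<close> is an error under every other hypothesis.\<close>
  have wrong: "measure (?P j) (D j n) \<le> q" if j: "j \<in> {1..M} - {m}" for j n
  proof -
    let ?E = "{(u, x) \<in> space (?P j). stoptime P u x = \<infinity> \<or> decision P u x \<noteq> j}"
    have E: "{\<omega> \<in> space (?P j). \<not> (\<exists>n. snd \<omega> \<in> decided_by P (fst \<omega>) j n)} = ?E"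
      unfolding ex_decided_by_iff by auto
    have [measurable]: "Measurable.pred (?P j) (\<lambda>\<omega>. snd \<omega> \<in> decided_by P (fst \<omega>) j n)" for n
      using dec by (simp add: split_beta')
    have "{\<omega> \<in> space (?P j). \<not> (\<exists>n. snd \<omega> \<in> decided_by P (fst \<omega>) j n)} \<in> sets (?P j)"
      by measurable
    then have "?E \<in> sets (?P j)" unfolding E .
    moreover have "D j n \<subseteq> ?E"
      using j ex_decided_by_iff[of _ P _ m] by (auto simp: D_def)
    ultimately have "emeasure (?P j) (D j n) \<le> emeasure (?P j) ?E"
      by (intro emeasure_mono)
    also have "\<dots> \<le> ennreal q" using q(1)[of j] j by (simp add: err_prob_def)
    finally show ?thesis using q(2) by (simp add: P.emeasure_eq_measure)
  qed
  have "1 - q \<le> measure (?P m) (\<Union>n. D m n)"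
  proof -
    have "(\<Union>n. D m n) = {(u, x) \<in> space (?P m). stoptime P u x \<noteq> \<infinity> \<and> decision P u x = m}"
      unfolding ex_decided_by_iff[symmetric] D_def by auto
    then have "space (?P m) - (\<Union>n. D m n) = {(u, x) \<in> space (?P m). stoptime P u x = \<infinity> \<or> decision P u x \<noteq> m}"
      by auto
    then have "emeasure (?P m) (space (?P m) - (\<Union>n. D m n)) \<le> ennreal q"
      using q(1)[OF m] by (simp add: err_prob_def)
    then have "measure (?P m) (space (?P m) - (\<Union>n. D m n)) \<le> q"
      using q(2) by (simp add: P.emeasure_eq_measure)
    moreover have "measure (?P m) (space (?P m) - (\<Union>n. D m n)) = 1 - measure (?P m) (\<Union>n. D m n)"
      using D_sets by (intro P.prob_compl) auto
    ultimately show ?thesis by simp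
  qed
  \<comment> \<open>The truncated events increase to the event of a correct decision, and the bound
    does not depend on \<open>n\<close>.\<close>
  moreover have "a * measure (?P m) (\<Union>n. D m n) \<le> ?I * T + exp a * q"
  proof (rule LIMSEQ_le_const2)
    have "incseq (D m)"
      by (rule incseq_SucI) (auto simp: D_def decided_by_def intro: le_SucI)
    then show "(\<lambda>n. a * measure (?P m) (D m n)) \<longlonglongrightarrow> a * measure (?P m) (\<Union>n. D m n)"
      using D_sets by (intro tendsto_mult_left P.finite_Lim_measure_incseq) auto
    have "a * measure (?P m) (D m n) \<le> ?I * T + exp a * q" for n
    proof -
      have "real (M - 1) * (a * measure (?P m) (D m n)) \<le>
          real (M - 1) * ?I * (\<Sum>t<n. measure (?P m) (R t))
          + (exp a - 1) * (\<Sum>j\<in>{1..M} - {m}. measure (?P j) (D j n))"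
        using randomized_bound[OF adm M m, of a n] by (simp add: D_def R_def split_beta')
      also have "\<dots> \<le> real (M - 1) * ?I * T + (exp a - 1) * (\<Sum>j\<in>{1..M} - {m}. q)"
        using a I by (intro add_mono mult_left_mono time sum_mono wrong) auto
      \<comment> \<open>The sum has \<open>M - 1\<close> terms, so this factor can be cancelled; the
        surplus \<open>- q\<close> is dropped.\<close>
      also have "\<dots> = real (M - 1) * (?I * T + exp a * q) - real (M - 1) * q"
        using m by (simp add: algebra_simps)
      also have "\<dots> \<le> real (M - 1) * (?I * T + exp a * q)"
        using q(2) by simp
      finally show ?thesis using M by (simp add: mult_le_cancel_left)
    qed
    then show "\<exists>N. \<forall>n\<ge>N. a * measure (?P m) (D m n) \<le> ?I * T + exp a * q" by auto
  qed
  ultimately show ?thesis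
    using a by (meson mult_left_mono order_trans)
qed

end

section \<open>Asymptotics for vanishing cost\<close>

text \<open>For \<open>k = - (c * ln c)\<close>, \<open>- ln k\<close> is \<open>- ln c\<close>
  minus \<open>ln (- ln c)\<close>. This correction, the factor \<open>1 - C * k\<close> tending to
  1 and the constant \<open>C\<close> cost less than any fraction \<open>\<epsilon>\<close> of
  \<open>- ln c\<close>.\<close>

lemma eventually_log_tradeoff:
  fixes C \<epsilon> :: real
  assumes "0 < \<epsilon>" "0 < C"
  shows "eventually (\<lambda>c. (1 - \<epsilon>) * - ln c \<le>
    - ln (- (c * ln c)) * (1 - C * - (c * ln c)) - C) (at_right 0)"
  using assms by real_asymp

theorem theorem5:
  fixes \<mu> :: "'a measure" and f g :: "'a \<Rightarrow> real" and M K :: nat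
    and \<Gamma> :: "real \<Rightarrow> 'a policy"
  assumes M2: "M \<ge> 2" and K1: "1 \<le> K" and KM: "K \<le> M"
    and f_meas: "f \<in> borel_measurable \<mu>" and f_nn: "\<And>y. f y \<ge> 0"
    and f_int: "(\<integral>\<^sup>+ y. ennreal (f y) \<partial>\<mu>) = 1"
    and g_meas: "g \<in> borel_measurable \<mu>" and g_nn: "\<And>y. g y \<ge> 0"
    and g_int: "(\<integral>\<^sup>+ y. ennreal (g y) \<partial>\<mu>) = 1"
    and abs_cont: "AE y in \<mu>. (f y > 0 \<longleftrightarrow> g y > 0)"
    and int_gf: "integrable \<mu> (\<lambda>y. g y * ln (g y / f y))"
    and int_fg: "integrable \<mu> (\<lambda>y. f y * ln (f y / g y))"
    and D_gf_pos: "KLdiv \<mu> g f > 0" and D_fg_pos: "KLdiv \<mu> f g > 0"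
    and mgf: "\<exists>\<epsilon>>0. \<forall>t. \<bar>t\<bar> < \<epsilon> \<longrightarrow>
                integrable \<mu> (\<lambda>y. f y * exp (t * ln (g y / f y))) \<and>
                integrable \<mu> (\<lambda>y. g y * exp (t * ln (g y / f y)))"
    and adm: "\<And>c. 0 < c \<Longrightarrow> c < 1 \<Longrightarrow> admissible M K \<mu> (\<Gamma> c)"
    and bigO: "\<forall>j\<in>{1..M}. \<exists>C. eventually
                 (\<lambda>c. risk \<mu> f g j c (\<Gamma> c) \<le> ennreal (C * (- (c * ln c)))) (at_right 0)"
  shows "\<forall>m\<in>{1..M}. \<forall>\<epsilon>>0. eventually
           (\<lambda>c. ennreal ((1 - \<epsilon>) * (- (c * ln c)) / Istar M K (KLdiv \<mu> g f) (KLdiv \<mu> f g))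
                  \<le> risk \<mu> f g m c (\<Gamma> c)) (at_right 0)"
proof (intro ballI allI impI)
  fix m and \<epsilon> :: real
  assume m: "m \<in> {1..M}" and \<epsilon>: "\<epsilon> > 0"
  interpret search_model \<mu> f g
    using f_meas f_nn f_int g_meas g_nn g_int abs_cont int_gf int_fg by unfold_locales
  let ?I = "Istar M K (KLdiv \<mu> g f) (KLdiv \<mu> f g)"
  have I: "?I > 0"
    using D_gf_pos D_fg_pos M2 K1 by (auto simp: Istar_def less_max_iff_disj intro!: divide_pos_pos)
  obtain C where C: "\<forall>j\<in>{1..M}. eventually
      (\<lambda>c. risk \<mu> f g j c (\<Gamma> c) \<le> ennreal (C j * (- (c * ln c)))) (at_right 0)"
    using bchoice[OF bigO] by blast
  \<comment> \<open>One constant for all hypotheses; the summand 1 keeps it positive.\<close>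
  define B where "B = 1 + (\<Sum>j\<in>{1..M}. \<bar>C j\<bar>)"
  have B_pos: "B > 0" unfolding B_def by (simp add: add_pos_nonneg sum_nonneg)
  have C_le: "C j \<le> B" if "j \<in> {1..M}" for j
    using member_le_sum[of j "{1..M}" "\<lambda>j. \<bar>C j\<bar>"] that by (simp add: B_def)
  have risks: "eventually (\<lambda>c. \<forall>j\<in>{1..M}. risk \<mu> f g j c (\<Gamma> c) \<le> ennreal (C j * (- (c * ln c))))
      (at_right 0)"
    using C by (intro eventually_ball_finite) auto
  \<comment> \<open>This makes the later choice \<open>a = - ln k\<close> nonnegative.\<close>
  have small: "eventually (\<lambda>c :: real. - (c * ln c) < 1) (at_right 0)"
    by real_asymp
  have c01: "eventually (\<lambda>c :: real. c \<in> {0<..<1}) (at_right 0)"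
    by (rule eventually_at_right_real) simp
  show "eventually (\<lambda>c. ennreal ((1 - \<epsilon>) * (- (c * ln c)) / ?I) \<le> risk \<mu> f g m c (\<Gamma> c)) (at_right 0)"
    using risks small c01 eventually_log_tradeoff[OF \<epsilon> B_pos]
  proof eventually_elim
    case (elim c)
    define k where "k = - (c * ln c)"
    have c: "0 < c" "c < 1" using elim by auto
    have k: "0 < k" "k < 1" using elim c by (auto simp: k_def mult_less_0_iff)
    have risk_le: "risk \<mu> f g j c (\<Gamma> c) \<le> ennreal (B * k)" if "j \<in> {1..M}" for j
    proof -
      have "risk \<mu> f g j c (\<Gamma> c) \<le> ennreal (C j * k)"
        using elim(1) that unfolding k_def by blast
      also have "\<dots> \<le> ennreal (B * k)"
        using C_le[OF that] k by (intro ennreal_leI mult_right_mono) auto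
      finally show ?thesis .
    qed
    have err: "err_prob \<mu> f g j (\<Gamma> c) \<le> ennreal (B * k)" if "j \<in> {1..M}" for j
      by (rule order_trans[OF _ risk_le[OF that]]) (simp add: risk_def)
    have time: "ennreal c * exp_time \<mu> f g m (\<Gamma> c) \<le> risk \<mu> f g m c (\<Gamma> c)"
      by (simp add: risk_def)
    \<comment> \<open>Finite risk and \<open>c > 0\<close> force a finite expected time.\<close>
    then have "exp_time \<mu> f g m (\<Gamma> c) \<noteq> \<top>"
      using risk_le[OF m] c by (auto simp: ennreal_mult_top top_unique)
    then obtain T where T: "exp_time \<mu> f g m (\<Gamma> c) = ennreal T" "0 \<le> T"
      by (cases "exp_time \<mu> f g m (\<Gamma> c)") auto
    \<comment> \<open>With \<open>a = - ln k\<close> and \<open>q = B * k\<close> the penalty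
      \<open>exp a * q\<close> is the constant \<open>B\<close>, while \<open>a\<close> grows like
      \<open>- ln c\<close>.\<close>
    have "- ln k * (1 - B * k) \<le> ?I * T + exp (- ln k) * (B * k)"
      using k I B_pos err by (intro error_time_tradeoff[OF adm[OF c] M2 m _ T]) auto
    also have "exp (- ln k) * (B * k) = B"
      using k by (simp add: exp_minus field_simps)
    finally have "(1 - \<epsilon>) * - ln c \<le> ?I * T"
      using elim by (simp add: k_def[symmetric])
    then have "c * ((1 - \<epsilon>) * - ln c) \<le> c * (?I * T)"
      using c by (intro mult_left_mono) auto
    then have "(1 - \<epsilon>) * k / ?I \<le> c * T"
      using I by (simp add: k_def field_simps)
    then have "ennreal ((1 - \<epsilon>) * k / ?I) \<le> ennreal c * exp_time \<mu> f g m (\<Gamma> c)"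
      using T c by (simp add: ennreal_mult[symmetric] ennreal_leI)
    then show ?case
      using time unfolding k_def by (rule order_trans)
  qed
qed

end
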